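(* Let $\mathbb{B}_0=(X_1,X_2,X_3)$ be the basis of $\mathrm{sl}(2,\mathbb{R})$ with $[X_1,X_2]=2X_3$, $[X_3,X_1]=2X_2$, $[X_3,X_2]=2X_1$. Let $a\neq0$, $b\ne0$ be real and consider the left invariant metric on $\widetilde{\mathrm{PSL}}(2,\mathbb{R})$ with matrix in $\mathbb{B}_0$ $$\frac1{2ab}\begin{pmatrix}a-8&-a&0\\-a&a+8&0\\0&0&\frac{8a}{b}\end{pmatrix}.$$ Its Ricci curvature and scalar curvature are $$M(\mathrm{ric},\mathbb{B}_0)=\frac1{4b}\begin{pmatrix}(a+2b-8)(a-2b)&4b^2-a^2&0\\4b^2-a^2&(a+2b+8)(a-2b)&0\\0&0&-\frac{8a^2}{b}\end{pmatrix},\qquad\mathfrak{s}=\frac12a(a-4b).$$ The Ricci curvature has signature $(+,-,-)$ if $a\neq2b$ and $(-,0,0)$ if $a=2b$.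
   Context: $\widetilde{\mathrm{PSL}}(2,\mathbb{R})$ is the universal covering group of $\mathrm{SL}(2,\mathbb{R})$. A left invariant metric on a Lie group with Lie algebra $\mathfrak{g}$ is identified with a nondegenerate symmetric bilinear form $\langle\,,\rangle$ on $\mathfrak{g}$. The Levi-Civita product $\mathrm{L}:\mathfrak{g}\times\mathfrak{g}\to\mathfrak{g}$ is given by $2\langle\mathrm{L}_uv,w\rangle=\langle[u,v],w\rangle+\langle[w,u],v\rangle+\langle[w,v],u\rangle$, the curvature by $\mathrm{K}(u,v)=\mathrm{L}_{[u,v]}-[\mathrm{L}_u,\mathrm{L}_v]$, the Ricci tensor by $\mathrm{ric}(u,v)=\mathrm{tr}(w\mapsto\mathrm{K}(u,w)v)$, the Ricci operator by $\langle\mathrm{Ric}(u),v\rangle=\mathrm{ric}(u,v)$, and the scalar curvature by $\mathfrak{s}=\mathrm{tr}(\mathrm{Ric})$. $M(\mathrm{ric},\mathbb{B}_0)$ is the Gram matrix of $\mathrm{ric}$ in $\mathbb{B}_0$. The signature of $\mathrm{ric}$ is its signature as a symmetric bilinear form (signs listed in any order). *)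

theory Defs
  imports "HOL-Analysis.Analysis" "HOL-Library.Multiset"
begin

section \<open>The Lie algebra of traceless real \<open>2 \<times> 2\<close> matrices\<close>

text \<open>This is the Lie algebra of \<open>SL(2,\<real>)\<close>, and hence also of its universal covering group.\<close>

typedef sl2 = "{A :: real^2^2. trace A = 0}"
  morphisms mat_of_sl2 sl2_of_mat
  by (rule exI[of _ 0]) (simp add: trace_def)

setup_lifting type_definition_sl2

instantiation sl2 :: real_vector
begin

lift_definition zero_sl2 :: sl2 is 0
  by (simp add: trace_def)

lift_definition plus_sl2 :: "sl2 \<Rightarrow> sl2 \<Rightarrow> sl2" is "(+)"
  by (simp add: trace_def sum.distrib)

lift_definition minus_sl2 :: "sl2 \<Rightarrow> sl2 \<Rightarrow> sl2" is "(-)"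
  by (simp add: trace_def sum_subtractf)

lift_definition uminus_sl2 :: "sl2 \<Rightarrow> sl2" is uminus
  by (simp add: trace_def sum_negf)

lift_definition scaleR_sl2 :: "real \<Rightarrow> sl2 \<Rightarrow> sl2" is "(*\<^sub>R)"
  by (simp add: trace_def sum_distrib_left[symmetric])

instance
  by standard (transfer, simp add: algebra_simps)+

end

lift_definition sl2_bracket :: "sl2 \<Rightarrow> sl2 \<Rightarrow> sl2" is "\<lambda>A B. A ** B - B ** A"
  by (metis trace_sub trace_mul_sym diff_self)

section \<open>Bases, traces and bilinear forms\<close>

definition is_ordered_basis :: "('g::real_vector)^'n \<Rightarrow> bool" where
  "is_ordered_basis X \<longleftrightarrow>
     inj (\<lambda>i. X $ i) \<and> independent (range (\<lambda>i. X $ i)) \<and> span (range (\<lambda>i. X $ i)) = UNIV"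

definition gram_matrix :: "('g \<Rightarrow> 'g \<Rightarrow> real) \<Rightarrow> 'g^'n \<Rightarrow> real^'n^'n" where
  "gram_matrix f X = (\<chi> i j. f (X $ i) (X $ j))"

text \<open>For a finite-dimensional space the choice of the basis is immaterial.\<close>

definition operator_trace :: "('g::real_vector \<Rightarrow> 'g) \<Rightarrow> real" where
  "operator_trace T =
     (let B = SOME B. independent B \<and> span B = (UNIV :: 'g set)
      in \<Sum>b\<in>B. representation B (T b) b)"

definition symmetric_bilinear :: "('g::real_vector \<Rightarrow> 'g \<Rightarrow> real) \<Rightarrow> bool" where
  "symmetric_bilinear f \<longleftrightarrow> bilinear f \<and> (\<forall>u v. f u v = f v u)"

text \<open>The multiset \<open>S\<close> lists the signs of the diagonal entries of the form in an orthogonal basis;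
  by Sylvester's law of inertia it does not depend on the basis.\<close>

definition has_signature :: "('g::real_vector \<Rightarrow> 'g \<Rightarrow> real) \<Rightarrow> real multiset \<Rightarrow> bool" where
  "has_signature f S \<longleftrightarrow> symmetric_bilinear f \<and>
     (\<exists>B. finite B \<and> independent B \<and> span B = UNIV \<and>
          (\<forall>u\<in>B. \<forall>v\<in>B. u \<noteq> v \<longrightarrow> f u v = 0) \<and>
          S = image_mset (\<lambda>u. sgn (f u u)) (mset_set B))"

section \<open>Curvature of a left invariant metric\<close>

text \<open>A left invariant metric on a Lie group is identified with a form \<open>ip\<close> on its Lie algebra,
  whose bracket is \<open>br\<close>.\<close>

definition left_invariant_metric :: "('g::real_vector \<Rightarrow> 'g \<Rightarrow> real) \<Rightarrow> bool" where
  "left_invariant_metric ip \<longleftrightarrow>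
     symmetric_bilinear ip \<and> (\<forall>u. (\<forall>v. ip u v = 0) \<longrightarrow> u = 0)"

definition levi_civita ::
  "('g::real_vector \<Rightarrow> 'g \<Rightarrow> 'g) \<Rightarrow> ('g \<Rightarrow> 'g \<Rightarrow> real) \<Rightarrow> 'g \<Rightarrow> 'g \<Rightarrow> 'g" where
  "levi_civita br ip u v =
     (THE x. \<forall>w. 2 * ip x w = ip (br u v) w + ip (br w u) v + ip (br w v) u)"

definition curvature ::
  "('g::real_vector \<Rightarrow> 'g \<Rightarrow> 'g) \<Rightarrow> ('g \<Rightarrow> 'g \<Rightarrow> real) \<Rightarrow> 'g \<Rightarrow> 'g \<Rightarrow> 'g \<Rightarrow> 'g" where
  "curvature br ip u v w =
     (let L = levi_civita br ip in L (br u v) w - (L u (L v w) - L v (L u w)))"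

definition ricci ::
  "('g::real_vector \<Rightarrow> 'g \<Rightarrow> 'g) \<Rightarrow> ('g \<Rightarrow> 'g \<Rightarrow> real) \<Rightarrow> 'g \<Rightarrow> 'g \<Rightarrow> real" where
  "ricci br ip u v = operator_trace (\<lambda>w. curvature br ip u w v)"

definition ricci_operator ::
  "('g::real_vector \<Rightarrow> 'g \<Rightarrow> 'g) \<Rightarrow> ('g \<Rightarrow> 'g \<Rightarrow> real) \<Rightarrow> 'g \<Rightarrow> 'g" where
  "ricci_operator br ip u = (THE x. \<forall>v. ip x v = ricci br ip u v)"

definition scalar_curvature ::
  "('g::real_vector \<Rightarrow> 'g \<Rightarrow> 'g) \<Rightarrow> ('g \<Rightarrow> 'g \<Rightarrow> real) \<Rightarrow> real" where
  "scalar_curvature br ip = operator_trace (ricci_operator br ip)"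

text \<open>The relations below determine a basis only up to automorphism; this one shows that they are satisfiable.\<close>

lemma ex_sl2_basis:
  "\<exists>X :: sl2^3. is_ordered_basis X \<and>
     sl2_bracket (X $ 1) (X $ 2) = 2 *\<^sub>R X $ 3 \<and>
     sl2_bracket (X $ 3) (X $ 1) = 2 *\<^sub>R X $ 2 \<and>
     sl2_bracket (X $ 3) (X $ 2) = 2 *\<^sub>R X $ 1"
proof -
  define x y z where "x = sl2_of_mat (vector [vector [0, 1], vector [-1, 0]])"
    and "y = sl2_of_mat (vector [vector [1, 0], vector [0, -1]])"
    and "z = sl2_of_mat (vector [vector [0, -1], vector [-1, 0]])"
  define X :: "sl2^3" where "X = vector [x, y, z]"
  have m: "mat_of_sl2 x = vector [vector [0, 1], vector [-1, 0]]"
    "mat_of_sl2 y = vector [vector [1, 0], vector [0, -1]]"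
    "mat_of_sl2 z = vector [vector [0, -1], vector [-1, 0]]"
    by (simp_all add: x_def y_def z_def sl2_of_mat_inverse trace_def sum_2)
  have X: "X $ 1 = x" "X $ 2 = y" "X $ 3 = z"
    by (simp_all add: X_def)
  have rel: "sl2_bracket x y = 2 *\<^sub>R z" "sl2_bracket z x = 2 *\<^sub>R y" "sl2_bracket z y = 2 *\<^sub>R x"
    by (simp_all add: mat_of_sl2_inject[symmetric] sl2_bracket.rep_eq scaleR_sl2.rep_eq m
        vec_eq_iff forall_2 matrix_matrix_mult_def sum_2)
  have lin: "p = 0 \<and> q = 0 \<and> r = 0" if "p *\<^sub>R x + q *\<^sub>R y + r *\<^sub>R z = 0" for p q r
  proof -
    have "mat_of_sl2 (p *\<^sub>R x + q *\<^sub>R y + r *\<^sub>R z) = 0"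
      using that by (simp add: zero_sl2.rep_eq)
    then show ?thesis
      by (simp add: plus_sl2.rep_eq scaleR_sl2.rep_eq m vec_eq_iff forall_2)
  qed
  have ne: "x \<noteq> y" "x \<noteq> z" "y \<noteq> z"
    by (simp_all add: mat_of_sl2_inject[symmetric] m vec_eq_iff forall_2)
  have rg: "range (\<lambda>i. X $ i) = {x, y, z}"
    by (auto simp: UNIV_3 X)
  have "inj (\<lambda>i. X $ i)"
    using ne by (simp add: inj_on_def forall_3 X)
  moreover have "independent {x, y, z}"
  proof
    assume "dependent {x, y, z}"
    then obtain u where "u x \<noteq> 0 \<or> u y \<noteq> 0 \<or> u z \<noteq> 0" "(\<Sum>v\<in>{x, y, z}. u v *\<^sub>R v) = 0"
      by (auto simp: dependent_finite)
    then show False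
      using ne lin[of "u x" "u y" "u z"] by (simp add: add.assoc)
  qed
  moreover have "v \<in> span {x, y, z}" for v
  proof -
    let ?A = "mat_of_sl2 v"
    have tr: "?A $ 1 $ 1 + ?A $ 2 $ 2 = 0"
      using mat_of_sl2[of v] by (simp add: trace_def sum_2)
    have "v = ((?A $ 1 $ 2 - ?A $ 2 $ 1) / 2) *\<^sub>R x + (?A $ 1 $ 1) *\<^sub>R y
              + (- (?A $ 1 $ 2 + ?A $ 2 $ 1) / 2) *\<^sub>R z"
      using tr by (simp add: mat_of_sl2_inject[symmetric] plus_sl2.rep_eq scaleR_sl2.rep_eq m
          vec_eq_iff forall_2 field_simps)
    then show ?thesis
      by (metis insertCI span_add span_base span_scale)
  qed
  ultimately have "is_ordered_basis X"
    by (auto simp: is_ordered_basis_def rg)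
  then show ?thesis
    using rel X by metis
qed

end

theory Submission
  imports Defs
begin

text \<open>Both the Levi-Civita product and the Ricci operator are defined by equations that are linear in
  the unknown and, by nondegeneracy of the metric, have at most one solution. So it suffices to
  exhibit their values on the basis and to check the defining equations there; the curvature and
  the traces then become finite computations in coordinates.\<close>

section \<open>Coordinates and traces in an ordered basis\<close>

text \<open>The functionals dual to the family \<open>X\<close>. They are read off from the
  set-based \<open>representation\<close>, so they are only meaningful when \<open>X\<close> is
  injective and independent.\<close>

definition coord :: "('g::real_vector)^'n \<Rightarrow> 'n \<Rightarrow> 'g \<Rightarrow> real" where
  "coord X i v = representation (range (\<lambda>i. X $ i)) v (X $ i)"

lemma is_ordered_basisD:
  assumes "is_ordered_basis X"
  shows "inj (\<lambda>i. X $ i)" "independent (range (\<lambda>i. X $ i))" "v \<in> span (range (\<lambda>i. X $ i))"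
  using assms by (simp_all add: is_ordered_basis_def)

lemma linear_coord:
  assumes "is_ordered_basis X"
  shows "linear (coord X i)"
proof -
  note D = is_ordered_basisD[OF assms]
  show ?thesis
    unfolding coord_def
    by (intro linearI)
      (simp_all only: representation_add[OF D(2) D(3) D(3)] representation_scale[OF D(2) D(3)]
        real_scaleR_def)
qed

lemma coord_basis:
  assumes "is_ordered_basis X"
  shows "coord X i (X $ j) = (if i = j then 1 else 0)"
  by (simp only: coord_def representation_basis[OF is_ordered_basisD(2)[OF assms] rangeI]
      inj_eq[OF is_ordered_basisD(1)[OF assms]])

lemma sum_coord_scaleR:
  fixes X :: "('g::real_vector)^'n"
  assumes X: "is_ordered_basis X"
  shows "(\<Sum>i\<in>UNIV. coord X i v *\<^sub>R X $ i) = v"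
proof -
  let ?B = "range (\<lambda>i. X $ i)"
  have "(\<Sum>b\<in>?B. representation ?B v b *\<^sub>R b) = v"
    by (intro sum_representation_eq is_ordered_basisD[OF X]) simp_all
  then show ?thesis
    by (simp only: coord_def sum.reindex[OF is_ordered_basisD(1)[OF X]] comp_def)
qed

lemma linear_eq_on_ordered_basis:
  assumes X: "is_ordered_basis X" and "linear f" "linear g" and eq: "\<And>i. f (X $ i) = g (X $ i)"
  shows "f = g"
proof
  fix v
  show "f v = g v"
    by (rule linear_eq_on_span[OF assms(2,3) _ is_ordered_basisD(3)[OF X]]) (metis eq imageE)
qed

lemma bilinear_eq_on_ordered_basis:
  assumes X: "is_ordered_basis X" and f: "bilinear f" and g: "bilinear g"
    and eq: "\<And>i j. f (X $ i) (X $ j) = g (X $ i) (X $ j)"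
  shows "f = g"
proof -
  have "f (X $ i) = g (X $ i)" for i
    using f g eq by (intro linear_eq_on_ordered_basis[OF X]) (auto simp: bilinear_def)
  then have "(\<lambda>u. f u v) = (\<lambda>u. g u v)" for v
    using f g by (intro linear_eq_on_ordered_basis[OF X]) (auto simp: bilinear_def)
  from fun_cong[OF this] show ?thesis
    by (intro ext)
qed

lemma linear_extension:
  fixes X :: "('g::real_vector)^'n" and A :: "'n \<Rightarrow> 'h::real_vector"
  assumes X: "is_ordered_basis X"
  shows "\<exists>T. linear T \<and> (\<forall>i. T (X $ i) = A i)"
proof (intro exI conjI allI)
  define T where "T v = (\<Sum>i\<in>UNIV. coord X i v *\<^sub>R A i)" for v
  show "linear T"
    using linear_coord[OF X]
    by (intro linearI)
      (simp_all add: T_def linear_add linear_scale algebra_simps sum.distrib scaleR_sum_right)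
  show "T (X $ j) = A j" for j
    by (simp add: T_def coord_basis[OF X] if_distrib[of "\<lambda>c. c *\<^sub>R _"] cong: if_cong)
qed

text \<open>Turns a table of products of basis vectors into a bilinear product on the whole space.
  The candidate for the Levi-Civita product is introduced this way.\<close>

lemma bilinear_extension:
  fixes X :: "('g::real_vector)^'n" and A :: "'n \<Rightarrow> 'n \<Rightarrow> 'h::real_vector"
  assumes X: "is_ordered_basis X"
  shows "\<exists>D. bilinear D \<and> (\<forall>i j. D (X $ i) (X $ j) = A i j)"
proof -
  have "\<exists>T. \<forall>i. linear (T i) \<and> (\<forall>j. T i (X $ j) = A i j)"
    by (intro choice allI linear_extension[OF X])
  then obtain T where T: "\<And>i. linear (T i)" "\<And>i j. T i (X $ j) = A i j"
    by blast
  define D where "D u v = (\<Sum>i\<in>UNIV. coord X i u *\<^sub>R T i v)" for u v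
  have "bilinear D"
    unfolding bilinear_def using linear_coord[OF X] T(1)
    by (intro conjI allI linearI)
      (simp_all add: D_def linear_add linear_scale algebra_simps sum.distrib scaleR_sum_right)
  moreover have "D (X $ i) (X $ j) = A i j" for i j
    by (simp add: D_def T(2) coord_basis[OF X] if_distrib[of "\<lambda>c. c *\<^sub>R _"] cong: if_cong)
  ultimately show ?thesis
    by blast
qed

text \<open>This is tr(PQ) = tr(QP) in disguise: expand each \<open>b\<close> in \<open>C\<close>,
  apply \<open>T\<close>, swap the two sums, and contract the sum over \<open>b\<close> back into
  \<open>T c\<close>. It makes the arbitrary choice of basis in \<open>operator_trace\<close>
  harmless.\<close>

lemma trace_representation_basis_independent:
  fixes T :: "'g::real_vector \<Rightarrow> 'g"
  assumes T: "linear T"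
    and B: "finite B" "independent B" "span B = UNIV"
    and C: "finite C" "independent C" "span C = UNIV"
  shows "(\<Sum>b\<in>B. representation B (T b) b) = (\<Sum>c\<in>C. representation C (T c) c)"
proof -
  have "representation B (T b) b = (\<Sum>c\<in>C. representation C b c * representation B (T c) b)" for b
  proof -
    have "T b = T (\<Sum>c\<in>C. representation C b c *\<^sub>R c)"
      using C by (subst sum_representation_eq) auto
    also have "\<dots> = (\<Sum>c\<in>C. representation C b c *\<^sub>R T c)"
      by (simp add: linear_sum[OF T] linear_scale[OF T])
    finally show ?thesis
      using B by (simp add: representation_sum representation_scale)
  qed
  then have "(\<Sum>b\<in>B. representation B (T b) b)
      = (\<Sum>b\<in>B. \<Sum>c\<in>C. representation C b c * representation B (T c) b)"
    by simp
  also have "\<dots> = (\<Sum>c\<in>C. \<Sum>b\<in>B. representation B (T c) b * representation C b c)"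
    by (subst sum.swap) (simp add: mult.commute)
  also have "\<dots> = (\<Sum>c\<in>C. representation C (T c) c)"
  proof (rule sum.cong)
    fix c
    have "(\<Sum>b\<in>B. representation B (T c) b * representation C b c)
        = representation C (\<Sum>b\<in>B. representation B (T c) b *\<^sub>R b) c"
      using C by (simp add: representation_sum representation_scale)
    also have "(\<Sum>b\<in>B. representation B (T c) b *\<^sub>R b) = T c"
      using B by (intro sum_representation_eq) auto
    finally show "(\<Sum>b\<in>B. representation B (T c) b * representation C b c)
        = representation C (T c) c" .
  qed simp
  finally show ?thesis .
qed

lemma operator_trace_ordered_basis:
  fixes X :: "('g::real_vector)^'n"
  assumes X: "is_ordered_basis X" and T: "linear T"
  shows "operator_trace T = (\<Sum>i\<in>UNIV. coord X i (T (X $ i)))"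
proof -
  let ?R = "range (\<lambda>i. X $ i)"
  define B where "B = (SOME B. independent B \<and> span B = (UNIV :: 'g set))"
  have R: "finite ?R" "independent ?R" "span ?R = UNIV"
    using X by (simp_all add: is_ordered_basis_def)
  then have "\<exists>B. independent B \<and> span B = (UNIV :: 'g set)"
    by blast
  then have "independent B \<and> span B = UNIV"
    unfolding B_def by (rule someI_ex)
  \<comment> \<open>An independent set inside the span of the finite set \<open>?R\<close> is
    finite. Otherwise the sum over \<open>B\<close> would just be the default value 0.\<close>
  moreover from this have "finite B"
    using independent_span_bound[OF R(1), of B] R(3) by simp
  ultimately have "operator_trace T = (\<Sum>b\<in>?R. representation ?R (T b) b)"
    using trace_representation_basis_independent[OF T _ _ _ R, of B]
    by (simp add: operator_trace_def B_def)
  then show ?thesis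
    by (simp only: coord_def sum.reindex[OF is_ordered_basisD(1)[OF X]] comp_def)
qed

section \<open>Bilinear forms\<close>

lemma symmetric_bilinear_ordered_basisI:
  assumes X: "is_ordered_basis X" and f: "bilinear f"
    and sym: "\<And>i j. f (X $ i) (X $ j) = f (X $ j) (X $ i)"
  shows "symmetric_bilinear f"
proof -
  have "bilinear (\<lambda>u v. f v u)"
    using f by (simp add: bilinear_def)
  then have "f = (\<lambda>u v. f v u)"
    using bilinear_eq_on_ordered_basis[OF X f] sym by blast
  then show ?thesis
    using f unfolding symmetric_bilinear_def by metis
qed

lemma has_signature_ordered_basisI:
  fixes Y :: "('g::real_vector)^'n"
  assumes Y: "is_ordered_basis Y" and f: "symmetric_bilinear f"
    and orth: "\<And>i j. i \<noteq> j \<Longrightarrow> f (Y $ i) (Y $ j) = 0"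
  shows "has_signature f (image_mset (\<lambda>i. sgn (f (Y $ i) (Y $ i))) (mset_set UNIV))"
proof -
  let ?B = "range (\<lambda>i. Y $ i)"
  have "inj (\<lambda>i. Y $ i)"
    using Y by (simp add: is_ordered_basis_def)
  \<comment> \<open>\<open>has_signature\<close> collects signs over a set of vectors; injectivity
    ensures that each index contributes exactly one sign.\<close>
  then have "mset_set ?B = image_mset (\<lambda>i. Y $ i) (mset_set UNIV)"
    by (simp add: image_mset_mset_set)
  then have "image_mset (\<lambda>i. sgn (f (Y $ i) (Y $ i))) (mset_set UNIV)
      = image_mset (\<lambda>u. sgn (f u u)) (mset_set ?B)"
    by (simp add: image_mset.compositionality comp_def)
  moreover have "f (Y $ i) (Y $ j) = 0" if "Y $ i \<noteq> Y $ j" for i j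
    using that orth by (cases "i = j") auto
  ultimately show ?thesis
    unfolding has_signature_def using Y f
    by (intro conjI exI[of _ ?B]) (simp_all only: is_ordered_basis_def, auto)
qed

lemma image_mset_UNIV_3: "image_mset f (mset_set (UNIV :: 3 set)) = {#f 1, f 2, f 3#}"
proof -
  have "mset_set {1, 2, 3 :: 3} = {#1, 2, 3#}"
    by (subst mset_set.insert; simp)+
  then show ?thesis
    unfolding UNIV_3 by simp
qed

text \<open>The functional \<open>\<lambda>u. f u (Y $ i)\<close> kills every other member of the
  family, hence their span, but not \<open>Y $ i\<close> itself. So no member lies in the span of
  the others.\<close>

lemma orthogonal_nonisotropic_ordered_basis:
  fixes Y :: "('g::real_vector)^'n"
  assumes f: "bilinear f"
    and orth: "\<And>i j. i \<noteq> j \<Longrightarrow> f (Y $ i) (Y $ j) = 0"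
    and nz: "\<And>i. f (Y $ i) (Y $ i) \<noteq> (0::real)"
    and span: "span (range (\<lambda>i. Y $ i)) = UNIV"
  shows "is_ordered_basis Y"
proof -
  have "inj (\<lambda>i. Y $ i)"
  proof (rule injI, rule ccontr)
    fix i j
    assume "Y $ i = Y $ j" "i \<noteq> j"
    with orth[of i j] nz[of i] show False
      by simp
  qed
  moreover have "independent (range (\<lambda>i. Y $ i))"
  proof
    assume "dependent (range (\<lambda>i. Y $ i))"
    then obtain i where i: "Y $ i \<in> span (range (\<lambda>i. Y $ i) - {Y $ i})"
      unfolding dependent_def by blast
    have "linear (\<lambda>u. f u (Y $ i))"
      using f by (simp add: bilinear_def)
    moreover have "f u (Y $ i) = 0" if "u \<in> range (\<lambda>i. Y $ i) - {Y $ i}" for u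
    proof -
      from that obtain j where "u = Y $ j" "Y $ j \<noteq> Y $ i"
        by blast
      with orth[of j i] show ?thesis
        by (cases "j = i") simp_all
    qed
    ultimately have "f (Y $ i) (Y $ i) = 0"
      using i by (rule linear_eq_0_on_span)
    with nz[of i] show False
      by simp
  qed
  ultimately show ?thesis
    using span by (simp add: is_ordered_basis_def)
qed

section \<open>The curvature in an ordered basis\<close>

lemma left_invariant_metric_eqI:
  assumes "left_invariant_metric ip" "\<And>w. ip x w = ip y w"
  shows "x = y"
proof -
  have "bilinear ip"
    using assms(1) by (simp add: left_invariant_metric_def symmetric_bilinear_def)
  then have "ip (x - y) w = 0" for w
    by (simp add: bilinear_lsub assms(2))
  then show ?thesis
    using assms(1) by (force simp: left_invariant_metric_def)
qed

text \<open>Both sides of the Koszul formula are trilinear, so basis triples suffice: first the two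
  arguments of the product are freed with the test vector \<open>X $ k\<close> fixed, then the test
  vector. Nondegeneracy gives uniqueness.\<close>

lemma levi_civita_ordered_basis:
  fixes X :: "('g::real_vector)^'n"
  assumes X: "is_ordered_basis X" and ip: "left_invariant_metric ip"
    and br: "bilinear br" and D: "bilinear D"
    and koszul: "\<And>i j k. 2 * ip (D (X $ i) (X $ j)) (X $ k)
      = ip (br (X $ i) (X $ j)) (X $ k) + ip (br (X $ k) (X $ i)) (X $ j)
        + ip (br (X $ k) (X $ j)) (X $ i)"
  shows "levi_civita br ip = D"
proof (intro ext)
  fix u v
  have ip': "bilinear ip"
    using ip by (simp add: left_invariant_metric_def symmetric_bilinear_def)
  note bil = bilinear_ladd bilinear_radd bilinear_lmul bilinear_rmul
  have "(\<lambda>u v. 2 * ip (D u v) (X $ k))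
      = (\<lambda>u v. ip (br u v) (X $ k) + ip (br (X $ k) u) v + ip (br (X $ k) v) u)" for k
    by (rule bilinear_eq_on_ordered_basis[OF X])
      (auto simp: bilinear_def koszul algebra_simps bil[OF ip'] bil[OF br] bil[OF D] intro!: linearI)
  then have eq: "2 * ip (D u v) (X $ k)
      = ip (br u v) (X $ k) + ip (br (X $ k) u) v + ip (br (X $ k) v) u" for k
    by meson
  have "(\<lambda>w. 2 * ip (D u v) w) = (\<lambda>w. ip (br u v) w + ip (br w u) v + ip (br w v) u)"
    by (rule linear_eq_on_ordered_basis[OF X])
      (auto simp: eq algebra_simps bil[OF ip'] bil[OF br] intro!: linearI)
  then have eq': "2 * ip (D u v) w = ip (br u v) w + ip (br w u) v + ip (br w v) u" for w
    by meson
  show "levi_civita br ip u v = D u v"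
    unfolding levi_civita_def
  proof (rule the_equality)
    fix x
    assume "\<forall>w. 2 * ip x w = ip (br u v) w + ip (br w u) v + ip (br w v) u"
    with eq' have "2 * ip x w = 2 * ip (D u v) w" for w
      by metis
    then show "x = D u v"
      by (intro left_invariant_metric_eqI[OF ip]) simp
  qed (simp add: eq')
qed

lemma ricci_ordered_basis:
  fixes X :: "('g::real_vector)^'n"
  assumes X: "is_ordered_basis X" and br: "bilinear br"
    and D: "bilinear D" and L: "levi_civita br ip = D"
  shows "ricci br ip u v
    = (\<Sum>k\<in>UNIV. coord X k (D (br u (X $ k)) v - (D u (D (X $ k) v) - D (X $ k) (D u v))))"
proof -
  note bil = bilinear_ladd bilinear_radd bilinear_lmul bilinear_rmul
  have "linear (\<lambda>w. D (br u w) v - (D u (D w v) - D w (D u v)))"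
    by (rule linearI) (simp_all add: bil[OF br] bil[OF D] algebra_simps)
  from operator_trace_ordered_basis[OF X this] show ?thesis
    by (simp add: ricci_def curvature_def L Let_def)
qed

text \<open>In coordinates the trace is a finite sum of coordinate functionals applied to curvature
  terms that are linear in each argument.\<close>

lemma bilinear_ricci:
  fixes X :: "('g::real_vector)^'n" and br :: "'g \<Rightarrow> 'g \<Rightarrow> 'g"
  assumes X: "is_ordered_basis X" and br: "bilinear br"
    and D: "bilinear D" and L: "levi_civita br ip = D"
  shows "bilinear (ricci br ip)"
proof -
  note bil = bilinear_ladd bilinear_radd bilinear_lmul bilinear_rmul
  have "linear (\<lambda>v. D (br u w) v - (D u (D w v) - D w (D u v)))"
    "linear (\<lambda>u. D (br u w) v - (D u (D w v) - D w (D u v)))" for u v w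
    by (rule linearI; simp add: bil[OF br] bil[OF D] algebra_simps)+
  from this[THEN linear_compose, OF linear_coord[OF X]] show ?thesis
    unfolding bilinear_def ricci_ordered_basis[OF X br D L] comp_def
    by (intro conjI allI linear_compose_sum ballI)
qed

text \<open>Bilinearity spreads the defining equation of the Ricci operator from basis pairs to all
  pairs, and nondegeneracy singles out \<open>R\<close>.\<close>

lemma ricci_operator_ordered_basis:
  assumes X: "is_ordered_basis X" and ip: "left_invariant_metric ip"
    and ric: "bilinear (ricci br ip)" and R: "linear R"
    and eq: "\<And>i j. ip (R (X $ i)) (X $ j) = ricci br ip (X $ i) (X $ j)"
  shows "ricci_operator br ip = R"
proof
  fix u
  have ip': "bilinear ip"
    using ip by (simp add: left_invariant_metric_def symmetric_bilinear_def)
  have "bilinear (\<lambda>u v. ip (R u) v)"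
    unfolding bilinear_def using ip' R
    by (auto intro!: linearI simp: bilinear_ladd bilinear_radd bilinear_lmul bilinear_rmul
        linear_add linear_scale)
  then have "(\<lambda>u v. ip (R u) v) = ricci br ip"
    using eq ric by (intro bilinear_eq_on_ordered_basis[OF X]) auto
  then have "ip (R u) v = ricci br ip u v" for v
    by metis
  then show "ricci_operator br ip u = R u"
    unfolding ricci_operator_def
    by (intro the_equality) (auto intro!: left_invariant_metric_eqI[OF ip])
qed

section \<open>The Lie algebra of \<open>SL(2,\<real>)\<close>\<close>

lemma matrix_add_rdistrib: "(A + B) ** C = A ** C + B ** (C :: real^'k^'n)"
  by (simp add: matrix_matrix_mult_def vec_eq_iff sum.distrib distrib_right)

lemma bilinear_sl2_bracket: "bilinear sl2_bracket"
proof -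
  have "sl2_bracket (u + v) w = sl2_bracket u w + sl2_bracket v w"
    "sl2_bracket w (u + v) = sl2_bracket w u + sl2_bracket w v"
    "sl2_bracket (c *\<^sub>R u) w = c *\<^sub>R sl2_bracket u w"
    "sl2_bracket w (c *\<^sub>R u) = c *\<^sub>R sl2_bracket w u" for u v w c
    by (simp_all add: sl2_bracket.rep_eq plus_sl2.rep_eq scaleR_sl2.rep_eq matrix_add_ldistrib
        matrix_add_rdistrib matrix_scalar_ac scalar_matrix_assoc[symmetric] scaleR_right_diff_distrib
        flip: mat_of_sl2_inject)
  then show ?thesis
    unfolding bilinear_def by (intro conjI allI linearI)
qed

lemma sl2_bracket_self: "sl2_bracket u u = 0"
  by transfer simp

lemma sl2_bracket_swap: "sl2_bracket u v = - sl2_bracket v u"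
  by transfer simp

theorem proposition4p8:
  fixes X :: "sl2^3" and a b :: real and ip :: "sl2 \<Rightarrow> sl2 \<Rightarrow> real"
  assumes "is_ordered_basis X"
    and "sl2_bracket (X $ 1) (X $ 2) = 2 *\<^sub>R X $ 3"
    and "sl2_bracket (X $ 3) (X $ 1) = 2 *\<^sub>R X $ 2"
    and "sl2_bracket (X $ 3) (X $ 2) = 2 *\<^sub>R X $ 1"
    and "a \<noteq> 0" and "b \<noteq> 0"
    and "left_invariant_metric ip"
    and "gram_matrix ip X = (1 / (2 * a * b)) *\<^sub>R
           vector [vector [a - 8,    -a,         0],
                   vector [   -a, a + 8,         0],
                   vector [    0,     0, 8 * a / b]]"
  shows "gram_matrix (ricci sl2_bracket ip) X = (1 / (4 * b)) *\<^sub>R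
           vector [vector [(a + 2 * b - 8) * (a - 2 * b), 4 * b^2 - a^2, 0],
                   vector [4 * b^2 - a^2, (a + 2 * b + 8) * (a - 2 * b), 0],
                   vector [0, 0, - (8 * a^2 / b)]]
       \<and> scalar_curvature sl2_bracket ip = 1 / 2 * a * (a - 4 * b)
       \<and> (a \<noteq> 2 * b \<longrightarrow> has_signature (ricci sl2_bracket ip) {#1, -1, -1#})
       \<and> (a = 2 * b \<longrightarrow> has_signature (ricci sl2_bracket ip) {#-1, 0, 0#})"
proof -
  note X = assms(1) and brX = assms(2-4) and nz = assms(5,6) and ip = assms(7)
  have bip: "bilinear ip"
    using ip by (simp add: left_invariant_metric_def symmetric_bilinear_def)
  have gram: "ip (X $ i) (X $ j) = ((1 / (2 * a * b)) *\<^sub>R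
           vector [vector [a - 8, -a, 0], vector [-a, a + 8, 0],
                   vector [0, 0, 8 * a / b]] :: real^3^3) $ i $ j" for i j
    using assms(8) by (metis (no_types, lifting) gram_matrix_def vec_lambda_beta)
  have g: "ip (X $ 1) (X $ 1) = (a - 8) / (2 * a * b)" "ip (X $ 1) (X $ 2) = - 1 / (2 * b)"
    "ip (X $ 2) (X $ 1) = - 1 / (2 * b)" "ip (X $ 2) (X $ 2) = (a + 8) / (2 * a * b)"
    "ip (X $ 1) (X $ 3) = 0" "ip (X $ 3) (X $ 1) = 0" "ip (X $ 2) (X $ 3) = 0"
    "ip (X $ 3) (X $ 2) = 0" "ip (X $ 3) (X $ 3) = 4 / b^2"
    using nz by (simp_all add: gram field_simps power2_eq_square)
  \<comment> \<open>Antisymmetry completes the bracket table. Only the three reversed pairs are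
    instantiated, so that rewriting terminates.\<close>
  note br = brX sl2_bracket_self
    sl2_bracket_swap[of "X $ 2" "X $ 1"] sl2_bracket_swap[of "X $ 1" "X $ 3"]
    sl2_bracket_swap[of "X $ 2" "X $ 3"]
  note bil = bilinear_ladd bilinear_radd bilinear_lmul bilinear_rmul bilinear_lneg bilinear_rneg
    bilinear_lsub bilinear_rsub bilinear_lzero bilinear_rzero

  \<comment> \<open>The Levi-Civita product\<close>
  define p where "p = a * (a - 2 * b) / (8 * b)"
  \<comment> \<open>Entry (i, j) is the product of \<open>X $ i\<close> and \<open>X $ j\<close>.
    The Koszul formula gives its inner products with the basis; inverting the Gram matrix, whose
    block for \<open>X $ 1\<close>, \<open>X $ 2\<close> has determinant -16/(a^2 b^2), gives the
    entry. \<open>p\<close> is the \<open>X $ 1\<close> coordinate of entry (1, 3), and transposed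
    entries differ by the bracket.\<close>
  define \<Gamma> :: "sl2^3^3" where "\<Gamma> = vector [
    vector [(- b / 4) *\<^sub>R X $ 3, (1 + b / 4) *\<^sub>R X $ 3, p *\<^sub>R X $ 1 + (p - a / b) *\<^sub>R X $ 2],
    vector [(b / 4 - 1) *\<^sub>R X $ 3, (- b / 4) *\<^sub>R X $ 3, (- p - a / b) *\<^sub>R X $ 1 - p *\<^sub>R X $ 2],
    vector [p *\<^sub>R X $ 1 + (p - a / b + 2) *\<^sub>R X $ 2, (2 - p - a / b) *\<^sub>R X $ 1 - p *\<^sub>R X $ 2, 0]]"
  obtain D where D: "bilinear D" "\<And>i j. D (X $ i) (X $ j) = \<Gamma> $ i $ j"
    using bilinear_extension[OF X, of "\<lambda>i j. \<Gamma> $ i $ j"] by blast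
  have DX: "D (X $ 1) (X $ 1) = (- b / 4) *\<^sub>R X $ 3" "D (X $ 1) (X $ 2) = (1 + b / 4) *\<^sub>R X $ 3"
    "D (X $ 1) (X $ 3) = p *\<^sub>R X $ 1 + (p - a / b) *\<^sub>R X $ 2"
    "D (X $ 2) (X $ 1) = (b / 4 - 1) *\<^sub>R X $ 3" "D (X $ 2) (X $ 2) = (- b / 4) *\<^sub>R X $ 3"
    "D (X $ 2) (X $ 3) = (- p - a / b) *\<^sub>R X $ 1 - p *\<^sub>R X $ 2"
    "D (X $ 3) (X $ 1) = p *\<^sub>R X $ 1 + (p - a / b + 2) *\<^sub>R X $ 2"
    "D (X $ 3) (X $ 2) = (2 - p - a / b) *\<^sub>R X $ 1 - p *\<^sub>R X $ 2"
    "D (X $ 3) (X $ 3) = 0"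
    by (simp_all add: D(2) \<Gamma>_def)
  \<comment> \<open>The 27 basis instances of the Koszul formula become rational identities in
    \<open>a\<close> and \<open>b\<close>.\<close>
  have "\<forall>i j k. 2 * ip (D (X $ i) (X $ j)) (X $ k)
      = ip (sl2_bracket (X $ i) (X $ j)) (X $ k) + ip (sl2_bracket (X $ k) (X $ i)) (X $ j)
        + ip (sl2_bracket (X $ k) (X $ j)) (X $ i)"
    using nz
    by (simp add: forall_3 DX br bil[OF bip] g p_def)
      (simp add: field_simps power2_eq_square)
  then have L: "levi_civita sl2_bracket ip = D"
    by (intro levi_civita_ordered_basis[OF X ip bilinear_sl2_bracket D(1)]) blast

  \<comment> \<open>The Ricci tensor\<close>
  note ricci_eq = ricci_ordered_basis[OF X bilinear_sl2_bracket D(1) L]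
  have bric: "bilinear (ricci sl2_bracket ip)"
    by (rule bilinear_ricci[OF X bilinear_sl2_bracket D(1) L])
  note lc = linear_add[OF linear_coord[OF X]] linear_diff[OF linear_coord[OF X]]
    linear_scale[OF linear_coord[OF X]] linear_neg[OF linear_coord[OF X]]
    linear_0[OF linear_coord[OF X]]
  let ?ric = "ricci sl2_bracket ip"
  have r: "?ric (X $ 1) (X $ 1) = (a + 2 * b - 8) * (a - 2 * b) / (4 * b)"
    "?ric (X $ 1) (X $ 2) = (4 * b^2 - a^2) / (4 * b)"
    "?ric (X $ 1) (X $ 3) = 0"
    "?ric (X $ 2) (X $ 1) = (4 * b^2 - a^2) / (4 * b)"
    "?ric (X $ 2) (X $ 2) = (a + 2 * b + 8) * (a - 2 * b) / (4 * b)"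
    "?ric (X $ 2) (X $ 3) = 0"
    "?ric (X $ 3) (X $ 1) = 0"
    "?ric (X $ 3) (X $ 2) = 0"
    "?ric (X $ 3) (X $ 3) = - 2 * a^2 / b^2"
    using nz
    by (simp_all add: ricci_eq sum_3 br DX bil[OF D(1)] lc coord_basis[OF X] p_def)
      (simp_all add: field_simps power2_eq_square)
  have G: "gram_matrix ?ric X = (1 / (4 * b)) *\<^sub>R
           vector [vector [(a + 2 * b - 8) * (a - 2 * b), 4 * b^2 - a^2, 0],
                   vector [4 * b^2 - a^2, (a + 2 * b + 8) * (a - 2 * b), 0],
                   vector [0, 0, - (8 * a^2 / b)]]"
    by (simp add: vec_eq_iff forall_3 gram_matrix_def r power2_eq_square)

  \<comment> \<open>The Ricci operator and the scalar curvature\<close>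
  define q where "q = a * (a - 2 * b) / 8"
  \<comment> \<open>The images of the basis vectors, found by applying the inverse Gram matrix of
    \<open>ip\<close> to the Ricci matrix; \<open>q\<close> is the common factor of the block for
    \<open>X $ 1\<close>, \<open>X $ 2\<close>. The diagonal coordinates \<open>q * (4 - b)\<close>,
    \<open>q * (b + 4)\<close> and \<open>- (a^2 / 2)\<close> add up to the scalar
    curvature.\<close>
  define \<rho> :: "sl2^3" where "\<rho> = vector [q *\<^sub>R ((4 - b) *\<^sub>R X $ 1 - b *\<^sub>R X $ 2),
    q *\<^sub>R (b *\<^sub>R X $ 1 + (b + 4) *\<^sub>R X $ 2), (- (a^2 / 2)) *\<^sub>R X $ 3]"
  obtain R where R: "linear R" "\<And>i. R (X $ i) = \<rho> $ i"
    using linear_extension[OF X, of "\<lambda>i. \<rho> $ i"] by blast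
  have "\<forall>i j. ip (R (X $ i)) (X $ j) = ?ric (X $ i) (X $ j)"
    using nz
    by (simp add: forall_3 R(2) \<rho>_def bil[OF bip] g r q_def)
      (simp add: field_simps power2_eq_square)
  then have "ricci_operator sl2_bracket ip = R"
    by (intro ricci_operator_ordered_basis[OF X ip bric R(1)]) blast
  then have S: "scalar_curvature sl2_bracket ip = 1 / 2 * a * (a - 4 * b)"
    by (simp add: scalar_curvature_def operator_trace_ordered_basis[OF X R(1)] sum_3 R(2) \<rho>_def lc
        coord_basis[OF X] q_def field_simps power2_eq_square)

  \<comment> \<open>The signature of the Ricci form\<close>
  have "\<forall>i j. ?ric (X $ i) (X $ j) = ?ric (X $ j) (X $ i)"
    by (simp add: forall_3 r)
  then have sric: "symmetric_bilinear ?ric"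
    by (intro symmetric_bilinear_ordered_basisI[OF X bric]) blast
  have "has_signature ?ric {#-1, 0, 0#}" if ab: "a = 2 * b"
  proof -
    \<comment> \<open>Here the Ricci matrix degenerates to diag(0, 0, -8), so \<open>X\<close>
      itself is an orthogonal basis.\<close>
    have "\<forall>i j. i \<noteq> j \<longrightarrow> ?ric (X $ i) (X $ j) = 0"
      by (simp add: forall_3 r ab power2_eq_square)
    then have "has_signature ?ric (image_mset (\<lambda>i. sgn (?ric (X $ i) (X $ i))) (mset_set UNIV))"
      by (intro has_signature_ordered_basisI[OF X sric]) blast
    then show ?thesis
      using nz by (simp add: image_mset_UNIV_3 r ab add_mset_commute)
  qed
  moreover have "has_signature ?ric {#1, -1, -1#}" if ab: "a \<noteq> 2 * b"
  proof -
    \<comment> \<open>\<open>X $ 1 + X $ 2\<close> is isotropic for the Ricci form; adding suitable multiples of it to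
      \<open>X $ 1 - X $ 2\<close> gives two orthogonal vectors with opposite squares.\<close>
    define d where "d = a + 2 * b"
    define Y :: "sl2^3" where "Y = vector [(d / 8) *\<^sub>R X $ 1 + (d / 8 - 2) *\<^sub>R X $ 2,
      (d / 8 + 2) *\<^sub>R X $ 1 + (d / 8) *\<^sub>R X $ 2, X $ 3]"
    have Y: "Y $ 1 = (d / 8) *\<^sub>R X $ 1 + (d / 8 - 2) *\<^sub>R X $ 2"
      "Y $ 2 = (d / 8 + 2) *\<^sub>R X $ 1 + (d / 8) *\<^sub>R X $ 2" "Y $ 3 = X $ 3"
      by (simp_all add: Y_def)
    \<comment> \<open>Put N = \<open>X $ 1 + X $ 2\<close>, W = \<open>X $ 1 - X $ 2\<close> and e =
      \<open>(a - 2 * b) / b\<close>. Then ric(N,N) = 0, ric(N,W) = -4e and ric(W,W) = de, so W + sN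
      and W + tN are orthogonal when s + t = d/4. \<open>Y $ 1\<close> and \<open>Y $ 2\<close> take
      s = d/8 - 1 and t = d/8 + 1, which makes their squares 8e and -8e.\<close>
    have "\<forall>i j. i \<noteq> j \<longrightarrow> ?ric (Y $ i) (Y $ j) = 0"
      using nz by (simp add: forall_3 Y bil[OF bric] r d_def) (simp add: field_simps power2_eq_square)
    then have orth: "?ric (Y $ i) (Y $ j) = 0" if "i \<noteq> j" for i j
      using that by blast
    define e where "e = (a - 2 * b) / b"
    define h where "h = 2 * a^2 / b^2"
    have eh: "e \<noteq> 0" "h > 0"
      using nz ab by (simp_all add: e_def h_def)
    have norms: "?ric (Y $ 1) (Y $ 1) = 8 * e" "?ric (Y $ 2) (Y $ 2) = - (8 * e)"
      "?ric (Y $ 3) (Y $ 3) = - h"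
      using nz by (simp_all add: Y bil[OF bric] r d_def e_def h_def)
        (simp_all add: field_simps power2_eq_square)
    have "\<forall>i. ?ric (Y $ i) (Y $ i) \<noteq> 0"
      using eh by (simp add: forall_3 norms)
    moreover have "span (range (\<lambda>i. Y $ i)) = UNIV"
    proof -
      let ?S = "span (range (\<lambda>i. Y $ i))"
      have comb: "s *\<^sub>R Y $ 1 + t *\<^sub>R Y $ 2
          = (s * (d / 8) + t * (d / 8 + 2)) *\<^sub>R X $ 1
            + (s * (d / 8 - 2) + t * (d / 8)) *\<^sub>R X $ 2" for s t
        by (simp only: Y scaleR_add_right scaleR_add_left scaleR_scaleR distrib_left add_ac)
      \<comment> \<open>The matrix expressing \<open>Y $ 1\<close>, \<open>Y $ 2\<close> in
        \<open>X $ 1\<close>, \<open>X $ 2\<close> has determinant 4 for every \<open>d\<close>; the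
        coefficients are the entries of its inverse.\<close>
      have "d / 32 * (d / 8) + (1 / 2 - d / 32) * (d / 8 + 2) = 1"
        "d / 32 * (d / 8 - 2) + (1 / 2 - d / 32) * (d / 8) = 0"
        "- (1 / 2 + d / 32) * (d / 8) + d / 32 * (d / 8 + 2) = 0"
        "- (1 / 2 + d / 32) * (d / 8 - 2) + d / 32 * (d / 8) = 1"
        by (simp_all add: field_simps)
      then have "X $ 1 = (d / 32) *\<^sub>R Y $ 1 + (1 / 2 - d / 32) *\<^sub>R Y $ 2"
        "X $ 2 = (- (1 / 2 + d / 32)) *\<^sub>R Y $ 1 + (d / 32) *\<^sub>R Y $ 2" "X $ 3 = Y $ 3"
        unfolding comb by (simp_all only: scaleR_one scaleR_zero_left add_0_left add_0_right Y(3))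
      then have "X $ 1 \<in> ?S" "X $ 2 \<in> ?S" "X $ 3 \<in> ?S"
        by (metis rangeI span_add span_base span_scale)+
      then have "\<forall>i. X $ i \<in> ?S"
        by (simp add: forall_3)
      then have "span (range (\<lambda>i. X $ i)) \<subseteq> ?S"
        by (intro span_minimal) auto
      then show ?thesis
        using X by (auto simp: is_ordered_basis_def)
    qed
    ultimately have "is_ordered_basis Y"
      using orth by (intro orthogonal_nonisotropic_ordered_basis[OF bric]) auto
    then have "has_signature ?ric (image_mset (\<lambda>i. sgn (?ric (Y $ i) (Y $ i))) (mset_set UNIV))"
      by (rule has_signature_ordered_basisI[OF _ sric orth])
    then show ?thesis
      \<comment> \<open>The sign of \<open>e\<close> decides which of \<open>Y $ 1\<close>,
        \<open>Y $ 2\<close> has positive square. Either way they contribute one sign of each kind,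
        and \<open>Y $ 3\<close> adds a second -1.\<close>
      using eh by (cases "e > 0") (simp_all add: image_mset_UNIV_3 norms add_mset_commute)
  qed
  ultimately show ?thesis
    using G S by blast
qed

end
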